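(* Let $\alpha,\beta\in\mathbb{R}$ with $\alpha\neq 0$, and let $(G_1,g,J)$ be the connected three-dimensional unimodular Lie group with left-invariant Lorentzian metric $g$ whose Lie algebra has a pseudo-orthonormal basis $\{e_1,e_2,e_3\}$, $e_3$ timelike, with $$[e_1,e_2]=\alpha e_1-\beta e_3,\quad [e_1,e_3]=-\alpha e_1-\beta e_2,\quad [e_2,e_3]=\beta e_1+\alpha e_2+\alpha e_3,$$ and with the product structure $J$ given by $Je_1=e_1$, $Je_2=e_2$, $Je_3=-e_3$. Then $(G_1,g,J)$ does not admit left-invariant Ricci collineations associated to the Kobayashi-Nomizu connection $\nabla^1$.
   Context: Pseudo-orthonormal with $e_3$ timelike means $g(e_1,e_1)=g(e_2,e_2)=1$, $g(e_3,e_3)=-1$, $g(e_i,e_j)=0$ for $i\ne j$. $J$ is extended left-invariantly to a $(1,1)$-tensor with $J^2=\mathrm{id}$. Let $\nabla$ be the Levi-Civita connection of $g$. The canonical connection is $\nabla^0_XY=\nabla_XY-\frac12(\nabla_XJ)JY$, and the Kobayashi-Nomizu connection is $$\nabla^1_XY=\nabla^0_XY-\tfrac14\big[(\nabla_YJ)JX-(\nabla_{JY}J)X\big],$$ with curvature $R^1(X,Y)Z=\nabla^1_X\nabla^1_YZ-\nabla^1_Y\nabla^1_XZ-\nabla^1_{[X,Y]}Z$. Its Ricci tensor is $$\mathrm{Ric}^1(X,Y)=-g(R^1(X,e_1)Y,e_1)-g(R^1(X,e_2)Y,e_2)+g(R^1(X,e_3)Y,e_3),$$ and its symmetrization is $\widetilde{\mathrm{Ric}}^1(X,Y)=\frac12\big(\mathrm{Ric}^1(X,Y)+\mathrm{Ric}^1(Y,X)\big)$.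 For a left-invariant vector field $\xi=\lambda_1e_1+\lambda_2e_2+\lambda_3e_3$ ($\lambda_i\in\mathbb{R}$), $$(L_\xi\widetilde{\mathrm{Ric}}^1)(X,Y)=\xi\big(\widetilde{\mathrm{Ric}}^1(X,Y)\big)-\widetilde{\mathrm{Ric}}^1([\xi,X],Y)-\widetilde{\mathrm{Ric}}^1(X,[\xi,Y]).$$ A left-invariant Ricci collineation associated to $\nabla^1$ is a left-invariant $\xi$ with $L_\xi\widetilde{\mathrm{Ric}}^1=0$. The group admits left-invariant Ricci collineations if there is a nonzero such $\xi$. *)

theory Defs
  imports "HOL-Analysis.Analysis"
begin

section \<open>Smooth manifolds and their tangent spaces\<close>

primrec times_diff_on ::
  "nat \<Rightarrow> 'e::euclidean_space set \<Rightarrow> ('e \<Rightarrow> 'f::real_normed_vector) \<Rightarrow> bool" where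
  "times_diff_on 0 S f \<longleftrightarrow> continuous_on S f"
| "times_diff_on (Suc n) S f \<longleftrightarrow>
     (\<forall>x\<in>S. f differentiable (at x)) \<and>
     (\<forall>v. times_diff_on n S (\<lambda>x. frechet_derivative f (at x) v))"

(* C-infinity; only used for open S *)
definition smooth_on :: "'e::euclidean_space set \<Rightarrow> ('e \<Rightarrow> 'f::real_normed_vector) \<Rightarrow> bool" where
  "smooth_on S f \<longleftrightarrow> (\<forall>n. times_diff_on n S f)"

(* A chart is a pair of its domain U and a map on U into the model space. *)
type_synonym ('a, 'e) chart = "'a set \<times> ('a \<Rightarrow> 'e)"

abbreviation chart_inv :: "('a, 'e) chart \<Rightarrow> 'e \<Rightarrow> 'a" where
  "chart_inv c \<equiv> inv_into (fst c) (snd c)"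

abbreviation chart_image :: "('a, 'e) chart \<Rightarrow> 'e set" where
  "chart_image c \<equiv> snd c ` fst c"

definition is_chart :: "('a::topological_space, 'e::euclidean_space) chart \<Rightarrow> bool" where
  "is_chart c \<longleftrightarrow> open (fst c) \<and> open (chart_image c) \<and>
     homeomorphism (fst c) (chart_image c) (snd c) (chart_inv c)"

(* The tangent space at p is the model space 'e itself: a vector in 'e stands for the tangent
   vector at p having these coordinates in the preferred chart "chart_at M p". The choice of
   preferred charts is arbitrary and need not depend continuously on p, so a smooth vector field
   is in general not a smooth map into 'e; see vector_field below. *)
record ('a, 'e) manifold_data =
  atlas :: "('a, 'e) chart set"
  chart_at :: "'a \<Rightarrow> ('a, 'e) chart"

definition smooth_manifold ::
  "('a::{t2_space,second_countable_topology}, 'e::euclidean_space, 'z) manifold_data_scheme \<Rightarrow> bool"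
where
  "smooth_manifold M \<longleftrightarrow>
     (\<forall>c\<in>atlas M. is_chart c) \<and>
     (\<forall>c\<in>atlas M. \<forall>d\<in>atlas M.
        smooth_on (snd c ` (fst c \<inter> fst d)) (snd d \<circ> chart_inv c)) \<and>
     (\<forall>p. chart_at M p \<in> atlas M \<and> p \<in> fst (chart_at M p))"

definition smooth_fun ::
  "('a, 'e::euclidean_space, 'z) manifold_data_scheme \<Rightarrow> ('a \<Rightarrow> real) \<Rightarrow> bool" where
  "smooth_fun M f \<longleftrightarrow> (\<forall>c\<in>atlas M. smooth_on (chart_image c) (f \<circ> chart_inv c))"

definition smooth_self_map ::
  "('a::topological_space, 'e::euclidean_space, 'z) manifold_data_scheme \<Rightarrow> ('a \<Rightarrow> 'a) \<Rightarrow> bool" where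
  "smooth_self_map M F \<longleftrightarrow> continuous_on UNIV F \<and>
     (\<forall>c\<in>atlas M. \<forall>d\<in>atlas M.
        smooth_on (snd c ` (fst c \<inter> F -` fst d)) (snd d \<circ> F \<circ> chart_inv c))"

(* coordinates in the chart c of the tangent vector v at p, and conversely *)
definition to_chart ::
  "('a, 'e::euclidean_space, 'z) manifold_data_scheme \<Rightarrow> ('a, 'e) chart \<Rightarrow> 'a \<Rightarrow> 'e \<Rightarrow> 'e" where
  "to_chart M c p v =
     frechet_derivative (snd c \<circ> chart_inv (chart_at M p)) (at (snd (chart_at M p) p)) v"

definition from_chart ::
  "('a, 'e::euclidean_space, 'z) manifold_data_scheme \<Rightarrow> ('a, 'e) chart \<Rightarrow> 'a \<Rightarrow> 'e \<Rightarrow> 'e" where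
  "from_chart M c p v =
     frechet_derivative (snd (chart_at M p) \<circ> chart_inv c) (at (snd c p)) v"

definition tangent_map ::
  "('a, 'e::euclidean_space, 'z) manifold_data_scheme \<Rightarrow> ('a \<Rightarrow> 'a) \<Rightarrow> 'a \<Rightarrow> 'e \<Rightarrow> 'e" where
  "tangent_map M F p v =
     frechet_derivative (snd (chart_at M (F p)) \<circ> F \<circ> chart_inv (chart_at M p))
       (at (snd (chart_at M p) p)) v"


section \<open>Vector fields\<close>

type_synonym ('a, 'e) field = "'a \<Rightarrow> 'e"

definition local_rep ::
  "('a, 'e::euclidean_space, 'z) manifold_data_scheme \<Rightarrow> ('a, 'e) chart \<Rightarrow> ('a, 'e) field \<Rightarrow> 'e \<Rightarrow> 'e"
where
  "local_rep M c X u = to_chart M c (chart_inv c u) (X (chart_inv c u))"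

definition vector_field ::
  "('a, 'e::euclidean_space, 'z) manifold_data_scheme \<Rightarrow> ('a, 'e) field \<Rightarrow> bool" where
  "vector_field M X \<longleftrightarrow> (\<forall>c\<in>atlas M. smooth_on (chart_image c) (local_rep M c X))"

(* the directional derivative X(f) *)
definition vf_apply ::
  "('a, 'e::euclidean_space, 'z) manifold_data_scheme \<Rightarrow> ('a, 'e) field \<Rightarrow> ('a \<Rightarrow> real) \<Rightarrow> 'a \<Rightarrow> real"
where
  "vf_apply M X f p =
     frechet_derivative (f \<circ> chart_inv (chart_at M p)) (at (snd (chart_at M p) p)) (X p)"

(* The local formula DY(X) - DX(Y), i.e. [X,Y]f = X(Yf) - Y(Xf), in the preferred chart at p,
   where the coordinate vectors of X and Y at p are X p and Y p. *)
definition lie_bracket ::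
  "('a, 'e::euclidean_space, 'z) manifold_data_scheme \<Rightarrow>
     ('a, 'e) field \<Rightarrow> ('a, 'e) field \<Rightarrow> ('a, 'e) field" where
  "lie_bracket M X Y p =
     (let c = chart_at M p; u = snd c p in
        frechet_derivative (local_rep M c Y) (at u) (X p)
        - frechet_derivative (local_rep M c X) (at u) (Y p))"

definition vf_add :: "('a, 'e::real_vector) field \<Rightarrow> ('a, 'e) field \<Rightarrow> ('a, 'e) field" where
  "vf_add X Y = (\<lambda>p. X p + Y p)"

definition vf_diff :: "('a, 'e::real_vector) field \<Rightarrow> ('a, 'e) field \<Rightarrow> ('a, 'e) field" where
  "vf_diff X Y = (\<lambda>p. X p - Y p)"

definition vf_scale :: "real \<Rightarrow> ('a, 'e::real_vector) field \<Rightarrow> ('a, 'e) field" where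
  "vf_scale r X = (\<lambda>p. r *\<^sub>R X p)"

definition vf_fscale :: "('a \<Rightarrow> real) \<Rightarrow> ('a, 'e::real_vector) field \<Rightarrow> ('a, 'e) field" where
  "vf_fscale f X = (\<lambda>p. f p *\<^sub>R X p)"


section \<open>Lorentzian metrics, product structures, connections\<close>

definition index :: "('e::euclidean_space \<Rightarrow> 'e \<Rightarrow> real) \<Rightarrow> nat" where
  "index b = Max {dim W | W. subspace W \<and> (\<forall>w\<in>W. w \<noteq> 0 \<longrightarrow> b w w < 0)}"

definition lorentzian_metric ::
  "('a, 'e::euclidean_space, 'z) manifold_data_scheme \<Rightarrow> ('a \<Rightarrow> 'e \<Rightarrow> 'e \<Rightarrow> real) \<Rightarrow> bool" where
  "lorentzian_metric M g \<longleftrightarrow>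
     2 \<le> DIM('e) \<and>
     (\<forall>p. bilinear (g p) \<and> (\<forall>v w. g p v w = g p w v) \<and>
          (\<forall>v. (\<forall>w. g p v w = 0) \<longrightarrow> v = 0) \<and> index (g p) = 1) \<and>
     (\<forall>c\<in>atlas M. \<forall>v w. smooth_on (chart_image c)
        (\<lambda>u. g (chart_inv c u) (from_chart M c (chart_inv c u) v) (from_chart M c (chart_inv c u) w)))"

definition metric_app ::
  "('a \<Rightarrow> 'e \<Rightarrow> 'e \<Rightarrow> real) \<Rightarrow> ('a, 'e) field \<Rightarrow> ('a, 'e) field \<Rightarrow> 'a \<Rightarrow> real" where
  "metric_app g X Y = (\<lambda>p. g p (X p) (Y p))"

definition product_structure ::
  "('a, 'e::euclidean_space, 'z) manifold_data_scheme \<Rightarrow> ('a \<Rightarrow> 'e \<Rightarrow> 'e) \<Rightarrow> bool" where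
  "product_structure M J \<longleftrightarrow>
     (\<forall>p. linear (J p) \<and> J p \<circ> J p = id) \<and>
     (\<forall>c\<in>atlas M. \<forall>v. smooth_on (chart_image c)
        (\<lambda>u. to_chart M c (chart_inv c u)
               (J (chart_inv c u) (from_chart M c (chart_inv c u) v))))"

definition endo_app :: "('a \<Rightarrow> 'e \<Rightarrow> 'e) \<Rightarrow> ('a, 'e) field \<Rightarrow> ('a, 'e) field" where
  "endo_app J X = (\<lambda>p. J p (X p))"

(* "nab X Y" is the covariant derivative of Y along X; its values are only constrained, and only
   matter, on smooth vector fields. *)
type_synonym ('a, 'e) conn = "('a, 'e) field \<Rightarrow> ('a, 'e) field \<Rightarrow> ('a, 'e) field"

definition affine_connection ::
  "('a, 'e::euclidean_space, 'z) manifold_data_scheme \<Rightarrow> ('a, 'e) conn \<Rightarrow> bool" where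
  "affine_connection M nab \<longleftrightarrow>
     (\<forall>X Y. vector_field M X \<longrightarrow> vector_field M Y \<longrightarrow> vector_field M (nab X Y)) \<and>
     (\<forall>X X' Y. vector_field M X \<longrightarrow> vector_field M X' \<longrightarrow> vector_field M Y \<longrightarrow>
        nab (vf_add X X') Y = vf_add (nab X Y) (nab X' Y)) \<and>
     (\<forall>f X Y. smooth_fun M f \<longrightarrow> vector_field M X \<longrightarrow> vector_field M Y \<longrightarrow>
        nab (vf_fscale f X) Y = vf_fscale f (nab X Y)) \<and>
     (\<forall>X Y Y'. vector_field M X \<longrightarrow> vector_field M Y \<longrightarrow> vector_field M Y' \<longrightarrow>
        nab X (vf_add Y Y') = vf_add (nab X Y) (nab X Y')) \<and>
     (\<forall>f X Y. smooth_fun M f \<longrightarrow> vector_field M X \<longrightarrow> vector_field M Y \<longrightarrow>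
        nab X (vf_fscale f Y) = vf_add (vf_fscale (vf_apply M X f) Y) (vf_fscale f (nab X Y)))"

definition levi_civita ::
  "('a, 'e::euclidean_space, 'z) manifold_data_scheme \<Rightarrow> ('a \<Rightarrow> 'e \<Rightarrow> 'e \<Rightarrow> real) \<Rightarrow>
     ('a, 'e) conn \<Rightarrow> bool" where
  "levi_civita M g nab \<longleftrightarrow>
     affine_connection M nab \<and>
     (\<forall>X Y. vector_field M X \<longrightarrow> vector_field M Y \<longrightarrow>
        vf_diff (nab X Y) (nab Y X) = lie_bracket M X Y) \<and>
     (\<forall>X Y Z. vector_field M X \<longrightarrow> vector_field M Y \<longrightarrow> vector_field M Z \<longrightarrow>
        vf_apply M X (metric_app g Y Z) =
          (\<lambda>p. metric_app g (nab X Y) Z p + metric_app g Y (nab X Z) p))"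

(* (nabla_X J) Y *)
definition cov_deriv_endo ::
  "('a, 'e::real_vector) conn \<Rightarrow> ('a \<Rightarrow> 'e \<Rightarrow> 'e) \<Rightarrow> ('a, 'e) conn" where
  "cov_deriv_endo nab J X Y = vf_diff (nab X (endo_app J Y)) (endo_app J (nab X Y))"

definition canonical_conn ::
  "('a, 'e::real_vector) conn \<Rightarrow> ('a \<Rightarrow> 'e \<Rightarrow> 'e) \<Rightarrow> ('a, 'e) conn" where
  "canonical_conn nab J X Y =
     vf_diff (nab X Y) (vf_scale (1/2) (cov_deriv_endo nab J X (endo_app J Y)))"

definition kobayashi_nomizu_conn ::
  "('a, 'e::real_vector) conn \<Rightarrow> ('a \<Rightarrow> 'e \<Rightarrow> 'e) \<Rightarrow> ('a, 'e) conn" where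
  "kobayashi_nomizu_conn nab J X Y =
     vf_diff (canonical_conn nab J X Y)
       (vf_scale (1/4)
         (vf_diff (cov_deriv_endo nab J Y (endo_app J X))
                  (cov_deriv_endo nab J (endo_app J Y) X)))"

definition curvature ::
  "('a, 'e::euclidean_space, 'z) manifold_data_scheme \<Rightarrow> ('a, 'e) conn \<Rightarrow>
     ('a, 'e) field \<Rightarrow> ('a, 'e) field \<Rightarrow> ('a, 'e) field \<Rightarrow> ('a, 'e) field" where
  "curvature M D X Y Z =
     vf_diff (vf_diff (D X (D Y Z)) (D Y (D X Z))) (D (lie_bracket M X Y) Z)"

(* Ricci tensor computed in a pseudo-orthonormal frame e1, e2, e3 with e3 timelike *)
definition ricci ::
  "('a, 'e::euclidean_space, 'z) manifold_data_scheme \<Rightarrow> ('a \<Rightarrow> 'e \<Rightarrow> 'e \<Rightarrow> real) \<Rightarrow>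
     ('a, 'e) field \<Rightarrow> ('a, 'e) field \<Rightarrow> ('a, 'e) field \<Rightarrow> ('a, 'e) conn \<Rightarrow>
     ('a, 'e) field \<Rightarrow> ('a, 'e) field \<Rightarrow> 'a \<Rightarrow> real" where
  "ricci M g e1 e2 e3 D X Y p =
     - metric_app g (curvature M D X e1 Y) e1 p
     - metric_app g (curvature M D X e2 Y) e2 p
     + metric_app g (curvature M D X e3 Y) e3 p"

definition symmetrized ::
  "(('a, 'e) field \<Rightarrow> ('a, 'e) field \<Rightarrow> 'a \<Rightarrow> real) \<Rightarrow>
     ('a, 'e) field \<Rightarrow> ('a, 'e) field \<Rightarrow> 'a \<Rightarrow> real" where
  "symmetrized T X Y p = (T X Y p + T Y X p) / 2"

definition lie_derivative ::
  "('a, 'e::euclidean_space, 'z) manifold_data_scheme \<Rightarrow> ('a, 'e) field \<Rightarrow>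
     (('a, 'e) field \<Rightarrow> ('a, 'e) field \<Rightarrow> 'a \<Rightarrow> real) \<Rightarrow>
     ('a, 'e) field \<Rightarrow> ('a, 'e) field \<Rightarrow> 'a \<Rightarrow> real" where
  "lie_derivative M \<xi> T X Y p =
     vf_apply M \<xi> (T X Y) p - T (lie_bracket M \<xi> X) Y p - T X (lie_bracket M \<xi> Y) p"


section \<open>Lie groups and left-invariant objects\<close>

record ('a, 'e) lie_group_data = "('a, 'e) manifold_data" +
  gmult :: "'a \<Rightarrow> 'a \<Rightarrow> 'a"
  gone :: 'a
  ginv :: "'a \<Rightarrow> 'a"

(* Smoothness of the multiplication is expressed in the product charts c1 x c2. *)
definition lie_group ::
  "('a::{t2_space,second_countable_topology}, 'e::euclidean_space, 'z) lie_group_data_scheme \<Rightarrow> bool"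
where
  "lie_group G \<longleftrightarrow>
     smooth_manifold G \<and>
     group (gmult G) (gone G) (ginv G) \<and>
     continuous_on UNIV (\<lambda>(x, y). gmult G x y) \<and>
     (\<forall>c1\<in>atlas G. \<forall>c2\<in>atlas G. \<forall>d\<in>atlas G.
        smooth_on {(u, v). u \<in> chart_image c1 \<and> v \<in> chart_image c2 \<and>
                           gmult G (chart_inv c1 u) (chart_inv c2 v) \<in> fst d}
          (\<lambda>(u, v). snd d (gmult G (chart_inv c1 u) (chart_inv c2 v)))) \<and>
     smooth_self_map G (ginv G)"

(* existence of a bi-invariant Haar measure *)
definition unimodular ::
  "('a::{t2_space,second_countable_topology}, 'e, 'z) lie_group_data_scheme \<Rightarrow> bool" where
  "unimodular G \<longleftrightarrow>
     (\<exists>\<mu> :: 'a measure. sets \<mu> = sets borel \<and>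
        (\<forall>K. compact K \<longrightarrow> emeasure \<mu> K < \<infinity>) \<and> emeasure \<mu> UNIV \<noteq> 0 \<and>
        (\<forall>a. distr \<mu> borel (gmult G a) = \<mu> \<and> distr \<mu> borel (\<lambda>x. gmult G x a) = \<mu>))"

definition lie_algebra ::
  "('a, 'e::euclidean_space, 'z) lie_group_data_scheme \<Rightarrow> ('a, 'e) field set" where
  "lie_algebra G = {X. vector_field G X \<and>
     (\<forall>a p. tangent_map G (gmult G a) p (X p) = X (gmult G a p))}"

definition left_invariant_metric ::
  "('a, 'e::euclidean_space, 'z) lie_group_data_scheme \<Rightarrow> ('a \<Rightarrow> 'e \<Rightarrow> 'e \<Rightarrow> real) \<Rightarrow> bool" where
  "left_invariant_metric G g \<longleftrightarrow>
     (\<forall>a p v w. g (gmult G a p) (tangent_map G (gmult G a) p v) (tangent_map G (gmult G a) p w)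
                  = g p v w)"

definition left_invariant_endo ::
  "('a, 'e::euclidean_space, 'z) lie_group_data_scheme \<Rightarrow> ('a \<Rightarrow> 'e \<Rightarrow> 'e) \<Rightarrow> bool" where
  "left_invariant_endo G J \<longleftrightarrow>
     (\<forall>a p v. J (gmult G a p) (tangent_map G (gmult G a) p v)
                = tangent_map G (gmult G a) p (J p v))"

definition vf_comb3 ::
  "real \<Rightarrow> real \<Rightarrow> real \<Rightarrow> ('a, 'e::real_vector) field \<Rightarrow> ('a, 'e) field \<Rightarrow> ('a, 'e) field \<Rightarrow>
     ('a, 'e) field" where
  "vf_comb3 a b c X Y Z = (\<lambda>p. a *\<^sub>R X p + b *\<^sub>R Y p + c *\<^sub>R Z p)"

definition lie_algebra_basis ::
  "('a, 'e::euclidean_space, 'z) lie_group_data_scheme \<Rightarrow>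
     ('a, 'e) field \<Rightarrow> ('a, 'e) field \<Rightarrow> ('a, 'e) field \<Rightarrow> bool" where
  "lie_algebra_basis G e1 e2 e3 \<longleftrightarrow>
     e1 \<in> lie_algebra G \<and> e2 \<in> lie_algebra G \<and> e3 \<in> lie_algebra G \<and>
     (\<forall>X\<in>lie_algebra G. \<exists>!(a, b, c). X = vf_comb3 a b c e1 e2 e3)"

(* e3 is the timelike vector *)
definition pseudo_orthonormal ::
  "('a \<Rightarrow> 'e \<Rightarrow> 'e \<Rightarrow> real) \<Rightarrow> ('a, 'e) field \<Rightarrow> ('a, 'e) field \<Rightarrow> ('a, 'e) field \<Rightarrow> bool" where
  "pseudo_orthonormal g e1 e2 e3 \<longleftrightarrow>
     (\<forall>p. g p (e1 p) (e1 p) = 1 \<and> g p (e2 p) (e2 p) = 1 \<and> g p (e3 p) (e3 p) = -1 \<and>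
          g p (e1 p) (e2 p) = 0 \<and> g p (e2 p) (e1 p) = 0 \<and>
          g p (e1 p) (e3 p) = 0 \<and> g p (e3 p) (e1 p) = 0 \<and>
          g p (e2 p) (e3 p) = 0 \<and> g p (e3 p) (e2 p) = 0)"

(* A left-invariant xi with L_xi of the symmetrized Ricci tensor of nabla^1 equal to zero, where
   nab is the Levi-Civita connection of g. The zero vector field is included. *)
definition left_invariant_ricci_collineation ::
  "('a, 'e::euclidean_space, 'z) lie_group_data_scheme \<Rightarrow> ('a \<Rightarrow> 'e \<Rightarrow> 'e \<Rightarrow> real) \<Rightarrow>
     ('a \<Rightarrow> 'e \<Rightarrow> 'e) \<Rightarrow> ('a, 'e) field \<Rightarrow> ('a, 'e) field \<Rightarrow> ('a, 'e) field \<Rightarrow>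
     ('a, 'e) conn \<Rightarrow> ('a, 'e) field \<Rightarrow> bool" where
  "left_invariant_ricci_collineation G g J e1 e2 e3 nab \<xi> \<longleftrightarrow>
     \<xi> \<in> lie_algebra G \<and>
     (\<forall>X Y. vector_field G X \<longrightarrow> vector_field G Y \<longrightarrow>
        lie_derivative G \<xi>
          (symmetrized (ricci G g e1 e2 e3 (kobayashi_nomizu_conn nab J))) X Y = (\<lambda>p. 0))"

definition admits_left_invariant_ricci_collineations ::
  "('a, 'e::euclidean_space, 'z) lie_group_data_scheme \<Rightarrow> ('a \<Rightarrow> 'e \<Rightarrow> 'e \<Rightarrow> real) \<Rightarrow>
     ('a \<Rightarrow> 'e \<Rightarrow> 'e) \<Rightarrow> ('a, 'e) field \<Rightarrow> ('a, 'e) field \<Rightarrow> ('a, 'e) field \<Rightarrow>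
     ('a, 'e) conn \<Rightarrow> bool" where
  "admits_left_invariant_ricci_collineations G g J e1 e2 e3 nab \<longleftrightarrow>
     (\<exists>\<xi>. left_invariant_ricci_collineation G g J e1 e2 e3 nab \<xi> \<and> \<xi> \<noteq> (\<lambda>p. 0))"

end

theory Submission
  imports Defs
begin

text \<open>On left-invariant fields the derivative terms in the Koszul formula and in the Lie derivative
  vanish, so the connections, curvature and Ricci tensor become polynomial expressions in frame
  coefficients. The symmetrized Ricci tensor has \<open>T11 = T22 = -(\<alpha>\<^sup>2 + \<beta>\<^sup>2)\<close>, \<open>T12 = \<alpha>\<beta>\<close>,
  \<open>T13 = -\<alpha>\<beta>/2\<close>, \<open>T23 = \<alpha>\<^sup>2/2\<close>, \<open>T33 = 0\<close>. For \<open>\<xi> = l1 e1 + l2 e2 + l3 e3\<close> the \<open>(1,1)\<close>,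
  \<open>(2,2)\<close> and \<open>(1,3)\<close> components of \<open>L\<^sub>\<xi> T = 0\<close> combine to
  \<open>l2 (\<alpha>\<^sup>2 (2\<alpha>\<^sup>2 + \<beta>\<^sup>2) + 2\<beta>\<^sup>4) = 0\<close>, whose second factor is positive; so \<open>l2 = 0\<close>, and then
  \<open>l1 = l3 = 0\<close>.\<close>

section \<open>Smooth functions on open sets\<close>

text \<open>A derivative depends only on the germ of the function. This matters because coordinate
  expressions of fields are controlled on the open chart image alone.\<close>

lemma frechet_derivative_cong_open:
  assumes "open S" "x \<in> S" "\<And>y. y \<in> S \<Longrightarrow> f y = h y" "f differentiable (at x)"
  shows "h differentiable (at x)" "frechet_derivative h (at x) = frechet_derivative f (at x)"
proof -
  have "(f has_derivative frechet_derivative f (at x)) (at x)"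
    using assms(4) by (simp add: frechet_derivative_works)
  then have h: "(h has_derivative frechet_derivative f (at x)) (at x)"
    by (rule has_derivative_transform_within_open[OF _ assms(1,2)]) (rule assms(3))
  then show "h differentiable (at x)"
    by (auto simp: differentiable_def)
  from frechet_derivative_at[OF h] show "frechet_derivative h (at x) = frechet_derivative f (at x)"
    by simp
qed

text \<open>The induction varies both functions: on \<open>S\<close> their directional derivatives
  agree again, which is the hypothesis for the next order.\<close>

lemma times_diff_on_cong:
  assumes "open S" "times_diff_on n S f" "\<And>y. y \<in> S \<Longrightarrow> f y = h y"
  shows "times_diff_on n S h"
  using assms(2,3)
proof (induction n arbitrary: f h)
  case 0
  then show ?case by (simp cong: continuous_on_cong)
next
  case (Suc n)
  have fd: "f differentiable (at x)" if "x \<in> S" for x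
    using Suc.prems(1) that by simp
  note cong = frechet_derivative_cong_open[OF assms(1) _ Suc.prems(2) fd]
  have "times_diff_on n S (\<lambda>x. frechet_derivative h (at x) v)" for v
  proof (rule Suc.IH)
    show "times_diff_on n S (\<lambda>x. frechet_derivative f (at x) v)"
      using Suc.prems(1) by simp
  qed (simp add: cong(2))
  then show ?case using cong(1) by simp
qed

lemma times_diff_on_const: "times_diff_on n S (\<lambda>x. c)"
  by (induction n arbitrary: c) simp_all

lemma frechet_derivative_lincomb:
  assumes "f differentiable (at x)" "h differentiable (at x)"
  shows "frechet_derivative (\<lambda>x. a *\<^sub>R f x + b *\<^sub>R h x) (at x) =
    (\<lambda>v. a *\<^sub>R frechet_derivative f (at x) v + b *\<^sub>R frechet_derivative h (at x) v)"
proof -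
  have "((\<lambda>x. a *\<^sub>R f x + b *\<^sub>R h x) has_derivative
    (\<lambda>v. a *\<^sub>R frechet_derivative f (at x) v + b *\<^sub>R frechet_derivative h (at x) v)) (at x)"
    using assms unfolding frechet_derivative_works
    by (intro has_derivative_add has_derivative_scaleR_right)
  from frechet_derivative_at[OF this] show ?thesis by simp
qed

lemma times_diff_on_lincomb:
  assumes "open S" "times_diff_on n S f" "times_diff_on n S h"
  shows "times_diff_on n S (\<lambda>x. a *\<^sub>R f x + b *\<^sub>R h x)"
  using assms(2,3)
proof (induction n arbitrary: f h)
  case 0
  then show ?case by (auto intro!: continuous_intros)
next
  case (Suc n)
  \<comment> \<open>The derivative splits linearly only at points of \<open>S\<close>, where both
    functions are known to be differentiable; hence the detour through
    \<open>times_diff_on_cong\<close>.\<close>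
  have "times_diff_on n S (\<lambda>x. frechet_derivative (\<lambda>x. a *\<^sub>R f x + b *\<^sub>R h x) (at x) v)" for v
  proof (rule times_diff_on_cong[OF assms(1)])
    show "times_diff_on n S
      (\<lambda>x. a *\<^sub>R frechet_derivative f (at x) v + b *\<^sub>R frechet_derivative h (at x) v)"
      using Suc by simp
  qed (use Suc.prems in \<open>simp add: frechet_derivative_lincomb\<close>)
  then show ?case using Suc.prems by simp
qed

lemma smooth_on_differentiable:
  assumes "smooth_on S f" "x \<in> S"
  shows "f differentiable (at x)"
proof -
  have "times_diff_on (Suc 0) S f" using assms(1) unfolding smooth_on_def by blast
  then show ?thesis using assms(2) by simp
qed

lemma smooth_on_lincomb3:
  assumes "open S" "smooth_on S f" "smooth_on S h" "smooth_on S k"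
  shows "smooth_on S (\<lambda>x. a *\<^sub>R f x + b *\<^sub>R h x + c *\<^sub>R k x)"
  unfolding smooth_on_def
proof
  fix n
  \<comment> \<open>The coefficient 1 lets the two-term rule apply twice.\<close>
  have "times_diff_on n S (\<lambda>x. 1 *\<^sub>R (a *\<^sub>R f x + b *\<^sub>R h x) + c *\<^sub>R k x)"
    using assms unfolding smooth_on_def by (intro times_diff_on_lincomb) auto
  then show "times_diff_on n S (\<lambda>x. a *\<^sub>R f x + b *\<^sub>R h x + c *\<^sub>R k x)" by simp
qed

section \<open>Constant-coefficient combinations of vector fields\<close>

lemma smooth_fun_const: "smooth_fun M (\<lambda>p. c)"
  by (simp add: smooth_fun_def smooth_on_def o_def times_diff_on_const)

lemma vf_apply_const: "vf_apply M X (\<lambda>p. c) = (\<lambda>p. 0)"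
  by (simp add: vf_apply_def o_def fun_eq_iff)

lemma chart_image_open:
  assumes "smooth_manifold M" "c \<in> atlas M"
  shows "open (chart_image c)"
  using assms by (auto simp: smooth_manifold_def is_chart_def)

text \<open>\<open>to_chart\<close> is the derivative of a transition map. Compatibility of charts
  makes that map differentiable at the point, so its \<open>frechet_derivative\<close> is a genuine
  linear map.\<close>

lemma linear_to_chart:
  assumes "smooth_manifold M" "c \<in> atlas M" "p \<in> fst c"
  shows "linear (to_chart M c p)"
proof -
  let ?d = "chart_at M p"
  have "?d \<in> atlas M" "p \<in> fst ?d"
    and "smooth_on (snd ?d ` (fst ?d \<inter> fst c)) (snd c \<circ> chart_inv ?d)"
    using assms by (auto simp: smooth_manifold_def)
  then have "(snd c \<circ> chart_inv ?d) differentiable (at (snd ?d p))"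
    using assms(3) by (intro smooth_on_differentiable[where S = "snd ?d ` (fst ?d \<inter> fst c)"]) auto
  from linear_frechet_derivative[OF this] show ?thesis
    by (simp add: to_chart_def[abs_def])
qed

lemma local_rep_comb3:
  assumes "smooth_manifold M" "k \<in> atlas M" "u \<in> chart_image k"
  shows "local_rep M k (vf_comb3 a b c X Y Z) u =
    a *\<^sub>R local_rep M k X u + b *\<^sub>R local_rep M k Y u + c *\<^sub>R local_rep M k Z u"
proof -
  have "linear (to_chart M k (chart_inv k u))"
    using assms by (intro linear_to_chart) (auto intro: inv_into_into)
  then show ?thesis
    by (simp add: local_rep_def vf_comb3_def linear_add linear_cmul)
qed

lemma vector_field_comb3:
  assumes "smooth_manifold M" "vector_field M X" "vector_field M Y" "vector_field M Z"
  shows "vector_field M (vf_comb3 a b c X Y Z)"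
  unfolding vector_field_def
proof
  fix k assume k: "k \<in> atlas M"
  note op = chart_image_open[OF assms(1) k]
  have "smooth_on (chart_image k)
    (\<lambda>u. a *\<^sub>R local_rep M k X u + b *\<^sub>R local_rep M k Y u + c *\<^sub>R local_rep M k Z u)"
    using assms k by (intro smooth_on_lincomb3 op) (auto simp: vector_field_def)
  then show "smooth_on (chart_image k) (local_rep M k (vf_comb3 a b c X Y Z))"
    unfolding smooth_on_def
    using times_diff_on_cong[OF op] local_rep_comb3[OF assms(1) k] by (metis (no_types, lifting))
qed

lemma lie_bracket_skew: "lie_bracket M X Y = vf_scale (-1) (lie_bracket M Y X)"
  by (simp add: lie_bracket_def vf_scale_def fun_eq_iff Let_def)

text \<open>Constant coefficients contribute no derivative terms, so the bracket is real-linear. One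
  half uses linearity of the derivative of \<open>W\<close> in its direction, the other the
  derivative of a linear combination. The right argument is reached through
  \<open>lie_bracket_skew\<close>.\<close>

lemma lie_bracket_comb3:
  assumes M: "smooth_manifold M"
    and "vector_field M X" "vector_field M Y" "vector_field M Z" "vector_field M W"
  shows "lie_bracket M (vf_comb3 a b c X Y Z) W =
    vf_comb3 a b c (lie_bracket M X W) (lie_bracket M Y W) (lie_bracket M Z W)"
proof
  fix p
  define k where "k = chart_at M p"
  define u where "u = snd k p"
  have k: "k \<in> atlas M" and u: "u \<in> chart_image k"
    using M by (auto simp: smooth_manifold_def k_def u_def)
  have d: "local_rep M k V differentiable (at u)" if "vector_field M V" for V
    using that k u smooth_on_differentiable unfolding vector_field_def by blast
  note dX = d[OF assms(2)] and dY = d[OF assms(3)] and dZ = d[OF assms(4)] and dW = d[OF assms(5)]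
  have "((\<lambda>u. a *\<^sub>R local_rep M k X u + b *\<^sub>R local_rep M k Y u + c *\<^sub>R local_rep M k Z u)
      has_derivative (\<lambda>v. a *\<^sub>R frechet_derivative (local_rep M k X) (at u) v
        + b *\<^sub>R frechet_derivative (local_rep M k Y) (at u) v
        + c *\<^sub>R frechet_derivative (local_rep M k Z) (at u) v)) (at u)"
    using dX dY dZ unfolding frechet_derivative_works
    by (intro has_derivative_add has_derivative_scaleR_right)
  then have "(local_rep M k (vf_comb3 a b c X Y Z)
      has_derivative (\<lambda>v. a *\<^sub>R frechet_derivative (local_rep M k X) (at u) v
        + b *\<^sub>R frechet_derivative (local_rep M k Y) (at u) v
        + c *\<^sub>R frechet_derivative (local_rep M k Z) (at u) v)) (at u)"
    by (rule has_derivative_transform_within_open[OF _ chart_image_open[OF M k] u])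
      (simp add: local_rep_comb3[OF M k])
  note D = frechet_derivative_at[OF this, symmetric]
  note lin = linear_frechet_derivative[OF dW]
  show "lie_bracket M (vf_comb3 a b c X Y Z) W p =
    vf_comb3 a b c (lie_bracket M X W) (lie_bracket M Y W) (lie_bracket M Z W) p"
    unfolding lie_bracket_def Let_def k_def[symmetric] u_def[symmetric] D
    by (simp add: vf_comb3_def lie_bracket_def Let_def k_def[symmetric] u_def[symmetric]
        linear_add[OF lin] linear_cmul[OF lin] algebra_simps)
qed

lemma comb3_as_sum:
  "vf_comb3 a b c X Y Z =
    vf_add (vf_add (vf_fscale (\<lambda>p. a) X) (vf_fscale (\<lambda>p. b) Y)) (vf_fscale (\<lambda>p. c) Z)"
  by (simp add: vf_comb3_def vf_add_def vf_fscale_def)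

text \<open>Closure of smooth fields was proved for \<open>vf_comb3\<close>; these degenerate
  combinations carry it over to the operations in which connection axioms are stated.\<close>

lemma fscale_as_comb3: "vf_fscale (\<lambda>p. a) X = vf_comb3 a 0 0 X X X"
  and add_as_comb3: "vf_add X Y = vf_comb3 1 1 0 X Y Y"
  by (simp_all add: vf_comb3_def vf_fscale_def vf_add_def)

lemma affine_connection_comb3:
  assumes M: "smooth_manifold M" and nab: "affine_connection M nab"
    and vf: "vector_field M X" "vector_field M Y" "vector_field M Z" "vector_field M W"
  shows "nab (vf_comb3 a b c X Y Z) W = vf_comb3 a b c (nab X W) (nab Y W) (nab Z W)"
    and "nab W (vf_comb3 a b c X Y Z) = vf_comb3 a b c (nab W X) (nab W Y) (nab W Z)"
proof -
  have s: "vector_field M (vf_fscale (\<lambda>p. r) V)" if "vector_field M V" for r V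
    using that by (simp add: fscale_as_comb3 vector_field_comb3[OF M])
  have t: "vector_field M (vf_add V V')" if "vector_field M V" "vector_field M V'" for V V'
    using that by (simp add: add_as_comb3 vector_field_comb3[OF M])
  have l: "nab (vf_add V V') W = vf_add (nab V W) (nab V' W)"
    "nab W (vf_add V V') = vf_add (nab W V) (nab W V')"
    if "vector_field M V" "vector_field M V'" for V V'
    using nab that vf(4) by (simp_all add: affine_connection_def)
  have m: "nab (vf_fscale (\<lambda>p. r) V) W = vf_fscale (\<lambda>p. r) (nab V W)" if "vector_field M V" for r V
    using nab that vf(4) by (simp add: affine_connection_def smooth_fun_const)
  have "nab W (vf_fscale (\<lambda>p. r) V) =
      vf_add (vf_fscale (vf_apply M W (\<lambda>p. r)) V) (vf_fscale (\<lambda>p. r) (nab W V))"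
    if "vector_field M V" for r V
    using nab that vf(4) by (simp add: affine_connection_def smooth_fun_const)
  \<comment> \<open>The Leibniz term differentiates a constant coefficient and vanishes.\<close>
  then have n: "nab W (vf_fscale (\<lambda>p. r) V) = vf_fscale (\<lambda>p. r) (nab W V)"
    if "vector_field M V" for r V
    using that by (simp add: vf_apply_const vf_add_def vf_fscale_def)
  show "nab (vf_comb3 a b c X Y Z) W = vf_comb3 a b c (nab X W) (nab Y W) (nab Z W)"
    "nab W (vf_comb3 a b c X Y Z) = vf_comb3 a b c (nab W X) (nab W Y) (nab W Z)"
    by (simp_all add: comb3_as_sum l m n s t vf)
qed

section \<open>Pseudo-orthonormal frames\<close>

text \<open>The calculus in frame coefficients involves no group law, so it is set up on any
  manifold with a global pseudo-orthonormal frame.\<close>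

locale pseudo_orthonormal_frame =
  fixes M :: "('a::{t2_space,second_countable_topology}, real^3, 'z) manifold_data_scheme"
    and g :: "'a \<Rightarrow> real^3 \<Rightarrow> real^3 \<Rightarrow> real"
    and e1 e2 e3 :: "'a \<Rightarrow> real^3"
  assumes manifold: "smooth_manifold M"
    and bilinear_g: "bilinear (g p)"
    and sym_g: "g p v w = g p w v"
    and frame_fields: "vector_field M e1" "vector_field M e2" "vector_field M e3"
    and orthonormal: "pseudo_orthonormal g e1 e2 e3"
begin

abbreviation F :: "real \<Rightarrow> real \<Rightarrow> real \<Rightarrow> 'a \<Rightarrow> real^3" where
  "F a b c \<equiv> vf_comb3 a b c e1 e2 e3"

lemma frame_as_comb: "e1 = F 1 0 0" "e2 = F 0 1 0" "e3 = F 0 0 1"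
  by (simp_all add: vf_comb3_def)

lemma gram:
  "g p (e1 p) (e1 p) = 1" "g p (e2 p) (e2 p) = 1" "g p (e3 p) (e3 p) = -1"
  "g p (e1 p) (e2 p) = 0" "g p (e2 p) (e1 p) = 0"
  "g p (e1 p) (e3 p) = 0" "g p (e3 p) (e1 p) = 0"
  "g p (e2 p) (e3 p) = 0" "g p (e3 p) (e2 p) = 0"
  using orthonormal by (auto simp: pseudo_orthonormal_def)

lemmas g_linear =
  bilinear_ladd[OF bilinear_g] bilinear_radd[OF bilinear_g]
  bilinear_lmul[OF bilinear_g] bilinear_rmul[OF bilinear_g]
  bilinear_lsub[OF bilinear_g] bilinear_rsub[OF bilinear_g]

lemma metric_comb: "metric_app g (F a b c) (F x y z) = (\<lambda>p. a * x + b * y - c * z)"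
  by (simp add: metric_app_def vf_comb3_def g_linear gram fun_eq_iff algebra_simps)

lemma comb_ops:
  "vf_diff (F a b c) (F x y z) = F (a - x) (b - y) (c - z)"
  "vf_scale r (F a b c) = F (r * a) (r * b) (r * c)"
  by (simp_all add: vf_comb3_def vf_diff_def vf_scale_def fun_eq_iff algebra_simps)

lemma comb_of_combs:
  "vf_comb3 a b c (F x1 y1 z1) (F x2 y2 z2) (F x3 y3 z3) =
    F (a * x1 + b * x2 + c * x3) (a * y1 + b * y2 + c * y3) (a * z1 + b * z2 + c * z3)"
  by (simp add: vf_comb3_def fun_eq_iff algebra_simps)

lemma vector_field_comb: "vector_field M (F a b c)"
  by (rule vector_field_comb3[OF manifold frame_fields])

text \<open>Pairing a linear relation with each frame vector isolates one coefficient, so the three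
  vectors are independent and span \<open>real^3\<close>. The minus sign compensates for
  \<open>e3\<close> having square -1.\<close>

lemma frame_expansion:
  "v = g p v (e1 p) *\<^sub>R e1 p + g p v (e2 p) *\<^sub>R e2 p - g p v (e3 p) *\<^sub>R e3 p"
proof -
  let ?B = "{e1 p, e2 p, e3 p}"
  have dist: "e1 p \<noteq> e2 p" "e1 p \<noteq> e3 p" "e2 p \<noteq> e3 p"
    using gram[of p] by force+
  have ind: "independent ?B"
    unfolding independent_explicit_finite_subsets
  proof (intro allI impI ballI)
    fix A u w
    assume A: "A \<subseteq> ?B" "finite A" and s: "(\<Sum>v\<in>A. u v *\<^sub>R v) = 0" and w: "w \<in> A"
    \<comment> \<open>Extending the coefficients by zero turns a relation on a subset into one on
      all three vectors.\<close>
    define f where "f v = (if v \<in> A then u v else 0)" for v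
    have "(\<Sum>v\<in>?B. f v *\<^sub>R v) = (\<Sum>v\<in>A. f v *\<^sub>R v)"
      using A by (intro sum.mono_neutral_right) (auto simp: f_def)
    also have "\<dots> = 0" using s by (simp add: f_def)
    finally have z: "f (e1 p) *\<^sub>R e1 p + f (e2 p) *\<^sub>R e2 p + f (e3 p) *\<^sub>R e3 p = 0"
      using dist by (simp add: add.assoc)
    have "g p (f (e1 p) *\<^sub>R e1 p + f (e2 p) *\<^sub>R e2 p + f (e3 p) *\<^sub>R e3 p) x = 0" for x
      unfolding z by (rule bilinear_lzero[OF bilinear_g])
    from this[of "e1 p"] this[of "e2 p"] this[of "e3 p"]
    have "f (e1 p) = 0" "f (e2 p) = 0" "f (e3 p) = 0"
      by (simp_all add: g_linear gram)
    then show "u w = 0" using A w by (auto simp: f_def split: if_splits)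
  qed
  have "dim (UNIV :: (real^3) set) \<le> card ?B" using dist by simp
  from card_ge_dim_independent[OF subset_UNIV ind this] have "span ?B = UNIV" by blast
  then have "v \<in> span ?B" by simp
  then obtain a b c where "v = a *\<^sub>R e1 p + b *\<^sub>R e2 p + c *\<^sub>R e3 p"
    by (auto simp: span_breakdown_eq algebra_simps)
  then show ?thesis by (simp add: g_linear gram)
qed

text \<open>Constant inner products with the frame force constant coefficients. This identifies
  \<open>nab X Y\<close> as a frame combination without first showing that it is
  left-invariant.\<close>

lemma field_eq_combI:
  assumes "metric_app g V e1 = (\<lambda>p. a)" "metric_app g V e2 = (\<lambda>p. b)"
    and "metric_app g V e3 = (\<lambda>p. - c)"
  shows "V = F a b c"
proof
  fix p
  have "g p (V p) (e1 p) = a" "g p (V p) (e2 p) = b" "g p (V p) (e3 p) = - c"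
    using assms by (simp_all add: metric_app_def fun_eq_iff)
  then show "V p = F a b c p"
    using frame_expansion[of "V p" p] by (simp add: vf_comb3_def)
qed

text \<open>For fields with constant inner products the derivative terms of the Koszul formula vanish.\<close>

lemma koszul_comb:
  fixes a b c x y z r s t :: real
  defines "X \<equiv> F a b c" and "Y \<equiv> F x y z" and "Z \<equiv> F r s t"
  assumes "levi_civita M g nab"
  shows "metric_app g (nab X Y) Z p =
    (metric_app g (lie_bracket M X Y) Z p - metric_app g (lie_bracket M Y Z) X p
      + metric_app g (lie_bracket M Z X) Y p) / 2"
proof -
  have vf: "vector_field M X" "vector_field M Y" "vector_field M Z"
    by (simp_all add: X_def Y_def Z_def vector_field_comb)
  have tor: "metric_app g (lie_bracket M U V) W p
      = metric_app g (nab U V) W p - metric_app g (nab V U) W p"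
    if "vector_field M U" "vector_field M V" for U V W
  proof -
    have "vf_diff (nab U V) (nab V U) = lie_bracket M U V"
      using that assms(4) unfolding levi_civita_def by blast
    from this[symmetric] show ?thesis by (simp add: metric_app_def vf_diff_def g_linear)
  qed
  have comp: "vf_apply M U (metric_app g V W)
      = (\<lambda>p. metric_app g (nab U V) W p + metric_app g V (nab U W) p)"
    if "vector_field M U" "vector_field M V" "vector_field M W" for U V W
    using that assms(4) unfolding levi_civita_def by blast
  \<comment> \<open>Metric compatibility with a constant inner product: the operator
    \<open>nab U\<close> is skew on such a pair.\<close>
  have met: "metric_app g (nab U V) W p + metric_app g (nab U W) V p = 0"
    if "vector_field M U" "vector_field M V" "vector_field M W"
      "metric_app g V W = (\<lambda>p. k)" for U V W k
  proof -
    have "metric_app g (nab U V) W p + metric_app g V (nab U W) p = 0"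
      using fun_cong[OF comp[OF that(1-3)], of p] that(4) by (simp add: vf_apply_const)
    then show ?thesis by (simp add: metric_app_def sym_g)
  qed
  have "metric_app g (nab X Y) Z p + metric_app g (nab X Z) Y p = 0"
    by (rule met[OF vf(1,2,3)]) (simp only: Y_def Z_def metric_comb)
  moreover have "metric_app g (nab Y Z) X p + metric_app g (nab Y X) Z p = 0"
    by (rule met[OF vf(2,3,1)]) (simp only: Z_def X_def metric_comb)
  moreover have "metric_app g (nab Z X) Y p + metric_app g (nab Z Y) X p = 0"
    by (rule met[OF vf(3,1,2)]) (simp only: X_def Y_def metric_comb)
  \<comment> \<open>Here \<open>x, y, z\<close> stand for the pairings of \<open>nab X Y\<close>,
    \<open>nab Y Z\<close>, \<open>nab Z X\<close> with the remaining field, and primes for those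
    with the last two fields exchanged. Skewness gives \<open>a = x + y\<close>,
    \<open>b = y + z\<close>, \<open>c = z + x\<close>.\<close>
  moreover have "x = (a - b + c) / 2"
    if "x + x' = 0" "y + y' = 0" "z + z' = 0" "a = x - y'" "b = y - z'" "c = z - x'"
    for a b c x y z x' y' z' :: real
    using that by simp
  ultimately show ?thesis
    using tor[OF vf(1,2), of Z] tor[OF vf(2,3), of X] tor[OF vf(3,1), of Y] by blast
qed

end

section \<open>The Lie algebra of type G1\<close>

locale g1_frame = pseudo_orthonormal_frame +
  fixes J :: "'a \<Rightarrow> real^3 \<Rightarrow> real^3"
    and nab :: "('a \<Rightarrow> real^3) \<Rightarrow> ('a \<Rightarrow> real^3) \<Rightarrow> ('a \<Rightarrow> real^3)"
    and \<alpha> \<beta> :: real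
  assumes brackets: "lie_bracket M e1 e2 = vf_comb3 \<alpha> 0 (- \<beta>) e1 e2 e3"
      "lie_bracket M e1 e3 = vf_comb3 (- \<alpha>) (- \<beta>) 0 e1 e2 e3"
      "lie_bracket M e2 e3 = vf_comb3 \<beta> \<alpha> \<alpha> e1 e2 e3"
    and linear_J: "linear (J p)"
    and J_frame: "endo_app J e1 = e1" "endo_app J e2 = e2" "endo_app J e3 = vf_scale (-1) e3"
    and levi_civita: "levi_civita M g nab"
begin

lemma lie_bracket_comb:
  "lie_bracket M (F a b c) (F x y z) =
    F (\<alpha> * (a * y - b * x) - \<alpha> * (a * z - c * x) + \<beta> * (b * z - c * y))
      (- \<beta> * (a * z - c * x) + \<alpha> * (b * z - c * y))
      (- \<beta> * (a * y - b * x) + \<alpha> * (b * z - c * y))"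
proof -
  note left = lie_bracket_comb3[OF manifold frame_fields]
  \<comment> \<open>Zero is written as \<open>F 0 0 0\<close> so that \<open>comb_of_combs\<close>
    can absorb it.\<close>
  have diag: "lie_bracket M V V = F 0 0 0" for V
    by (simp add: lie_bracket_def Let_def vf_comb3_def fun_eq_iff)
  note skew = lie_bracket_skew[of M e2 e1] lie_bracket_skew[of M e3 e1] lie_bracket_skew[of M e3 e2]
  note rev = brackets skew[unfolded brackets comb_ops] diag
  have r: "lie_bracket M V (F x y z) =
      vf_scale (-1) (vf_comb3 x y z (lie_bracket M e1 V) (lie_bracket M e2 V) (lie_bracket M e3 V))"
    if "vector_field M V" for V
    using left[OF that] lie_bracket_skew[of M V "F x y z"] by simp
  show ?thesis
    unfolding left[OF vector_field_comb] r[OF frame_fields(1)] r[OF frame_fields(2)]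
      r[OF frame_fields(3)] rev comb_of_combs comb_ops
    by (rule arg_cong3[where f = F]) (simp_all add: algebra_simps)
qed

lemma endo_comb: "endo_app J (F a b c) = F a b (- c)"
proof
  fix p
  have "J p (e1 p) = e1 p" "J p (e2 p) = e2 p" "J p (e3 p) = - e3 p"
    using J_frame by (auto simp: endo_app_def vf_scale_def fun_eq_iff)
  then show "endo_app J (F a b c) p = F a b (- c) p"
    by (simp add: endo_app_def vf_comb3_def linear_add[OF linear_J] linear_cmul[OF linear_J])
qed

lemma levi_civita_comb:
  "nab (F a b c) (F x y z) =
    F (a * (\<alpha> * y - \<alpha> * z) + b * (\<beta> / 2 * z) - c * (\<beta> / 2 * y))
      (- a * (\<alpha> * x + \<beta> / 2 * z) + b * (\<alpha> * z) + c * (\<beta> / 2 * x - \<alpha> * z))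
      (- a * (\<alpha> * x + \<beta> / 2 * y) + b * (\<beta> / 2 * x + \<alpha> * y) - c * (\<alpha> * y))"
proof (rule field_eq_combI; rule ext)
  fix p
  note k = koszul_comb[OF levi_civita, unfolded lie_bracket_comb metric_comb]
  \<comment> \<open>Each frame vector is rewritten as a combination, so that the Koszul formula
    becomes a polynomial identity.\<close>
  show "metric_app g (nab (F a b c) (F x y z)) e1 p =
      a * (\<alpha> * y - \<alpha> * z) + b * (\<beta> / 2 * z) - c * (\<beta> / 2 * y)"
    by (subst frame_as_comb(1), subst k) (simp add: algebra_simps add_divide_distrib diff_divide_distrib)
  show "metric_app g (nab (F a b c) (F x y z)) e2 p =
      - a * (\<alpha> * x + \<beta> / 2 * z) + b * (\<alpha> * z) + c * (\<beta> / 2 * x - \<alpha> * z)"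
    by (subst frame_as_comb(2), subst k) (simp add: algebra_simps add_divide_distrib diff_divide_distrib)
  show "metric_app g (nab (F a b c) (F x y z)) e3 p =
      - (- a * (\<alpha> * x + \<beta> / 2 * y) + b * (\<beta> / 2 * x + \<alpha> * y) - c * (\<alpha> * y))"
    by (subst frame_as_comb(3), subst k) (simp add: algebra_simps add_divide_distrib diff_divide_distrib)
qed

text \<open>The result respects the splitting into eigenspaces of \<open>J\<close>: its first two
  coefficients use only \<open>x\<close> and \<open>y\<close>, its third only \<open>z\<close>. For
  arguments from opposite eigenspaces it is their bracket projected to the eigenspace of the
  second.\<close>

lemma kobayashi_nomizu_comb:
  "kobayashi_nomizu_conn nab J (F a b c) (F x y z) =
    F (a * \<alpha> * y + c * (\<alpha> * x - \<beta> * y)) (- a * \<alpha> * x + c * (\<beta> * x - \<alpha> * y)) (b * \<alpha> * z)"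
  unfolding kobayashi_nomizu_conn_def canonical_conn_def cov_deriv_endo_def
    endo_comb levi_civita_comb comb_ops
  by (rule arg_cong3[where f = F]) (simp_all add: field_simps)

text \<open>Every term contains \<open>a\<close> or \<open>b\<close>, so the tensor vanishes when
  its first argument is \<open>e3\<close> but not when its second is. This asymmetry produces the
  halves in the symmetrized tensor.\<close>

lemma ricci_comb:
  "ricci M g e1 e2 e3 (kobayashi_nomizu_conn nab J) (F a b c) (F x y z) p =
    - (\<alpha>\<^sup>2 + \<beta>\<^sup>2) * (a * x + b * y) + \<alpha> * \<beta> * (a * y + b * x) - \<alpha> * \<beta> * a * z + \<alpha>\<^sup>2 * b * z"
proof -
  have "ricci M g (F 1 0 0) (F 0 1 0) (F 0 0 1) (kobayashi_nomizu_conn nab J)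
      (F a b c) (F x y z) p =
    - (\<alpha>\<^sup>2 + \<beta>\<^sup>2) * (a * x + b * y) + \<alpha> * \<beta> * (a * y + b * x) - \<alpha> * \<beta> * a * z + \<alpha>\<^sup>2 * b * z"
    unfolding ricci_def curvature_def lie_bracket_comb kobayashi_nomizu_comb comb_ops metric_comb
    by simp algebra
  then show ?thesis by (simp add: frame_as_comb[symmetric])
qed

lemma symmetrized_ricci_comb:
  "symmetrized (ricci M g e1 e2 e3 (kobayashi_nomizu_conn nab J)) (F a b c) (F x y z) =
    (\<lambda>p. - (\<alpha>\<^sup>2 + \<beta>\<^sup>2) * (a * x + b * y) + \<alpha> * \<beta> * (a * y + b * x)
      - \<alpha> * \<beta> / 2 * (a * z + c * x) + \<alpha>\<^sup>2 / 2 * (b * z + c * y))"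
  by (simp add: symmetrized_def ricci_comb fun_eq_iff field_simps)

section \<open>The linear system for the coefficients of a collineation\<close>

lemma ricci_collineation_trivial:
  assumes "\<alpha> \<noteq> 0"
    and "\<And>X Y p. \<lbrakk>vector_field M X; vector_field M Y\<rbrakk> \<Longrightarrow>
      lie_derivative M (F l1 l2 l3)
        (symmetrized (ricci M g e1 e2 e3 (kobayashi_nomizu_conn nab J))) X Y p = 0"
  shows "l1 = 0" "l2 = 0" "l3 = 0"
proof -
  have "lie_derivative M (F l1 l2 l3)
      (symmetrized (ricci M g e1 e2 e3 (kobayashi_nomizu_conn nab J))) (F a b c) (F x y z) p = 0"
    for a b c x y z p
    by (intro assms(2) vector_field_comb)
  \<comment> \<open>The tensor is constant on frame combinations, so only its two bracket terms
    remain in the Lie derivative.\<close>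
  note L = this[unfolded lie_derivative_def
      lie_bracket_comb symmetrized_ricci_comb vf_apply_const]
  have "\<alpha> * (l2 * (2 * \<alpha>\<^sup>2 + \<beta>\<^sup>2) - 2 * l3 * \<alpha>\<^sup>2) = 0"
    using L[where a=1 and b=0 and c=0 and x=1 and y=0 and z=0]
    by (simp add: field_simps power2_eq_square)
  then have 11: "l2 * (2 * \<alpha>\<^sup>2 + \<beta>\<^sup>2) = 2 * l3 * \<alpha>\<^sup>2" using assms(1) by simp
  have "\<alpha>\<^sup>2 * (l1 * \<beta> + l3 * \<alpha>) = 0"
    using L[where a=0 and b=1 and c=0 and x=0 and y=1 and z=0]
    by (simp add: field_simps power2_eq_square)
  then have 22: "l3 * \<alpha> = - l1 * \<beta>" using assms(1) by simp
  have 13: "l1 * \<alpha>^3 = l2 * \<beta>^3"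
    using L[where a=1 and b=0 and c=0 and x=0 and y=0 and z=1]
    by (simp add: field_simps power2_eq_square power3_eq_cube)
  \<comment> \<open>Multiply \<open>11\<close> by \<open>\<alpha>\<^sup>2\<close>: by
    \<open>22\<close> the right-hand side becomes \<open>- 2 * \<alpha>^3 * l1 * \<beta>\<close>,
    which is \<open>- 2 * l2 * \<beta>^4\<close> by \<open>13\<close>.\<close>
  have "l2 * (\<alpha>\<^sup>2 * (2 * \<alpha>\<^sup>2 + \<beta>\<^sup>2) + 2 * \<beta>^4) = 0"
    using 11 22 13 by algebra
  \<comment> \<open>Positivity comes from \<alpha> alone, since \<beta> may be zero.\<close>
  moreover have "\<alpha>\<^sup>2 * (2 * \<alpha>\<^sup>2 + \<beta>\<^sup>2) + 2 * \<beta>^4 > 0"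
    using assms(1) by (intro add_pos_nonneg mult_pos_pos) simp_all
  ultimately show l2: "l2 = 0" by (metis less_irrefl mult_eq_0_iff)
  show "l1 = 0" using 13 l2 assms(1) by simp
  show "l3 = 0" using 11 l2 assms(1) by simp
qed

end

section \<open>From the Lie group to its frame\<close>

theorem theorem3p7:
  fixes G :: "('a::{t2_space,second_countable_topology}, real^3) lie_group_data"
    and g :: "'a \<Rightarrow> real^3 \<Rightarrow> real^3 \<Rightarrow> real"
    and J :: "'a \<Rightarrow> real^3 \<Rightarrow> real^3"
    and e1 e2 e3 :: "'a \<Rightarrow> real^3"
    and nab :: "('a \<Rightarrow> real^3) \<Rightarrow> ('a \<Rightarrow> real^3) \<Rightarrow> ('a \<Rightarrow> real^3)"
    and \<alpha> \<beta> :: real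
  assumes "\<alpha> \<noteq> 0"
    and "lie_group G" and "connected (UNIV :: 'a set)" and "unimodular G"
    and "lorentzian_metric G g" and "left_invariant_metric G g"
    and "lie_algebra_basis G e1 e2 e3" and "pseudo_orthonormal g e1 e2 e3"
    and "lie_bracket G e1 e2 = vf_comb3 \<alpha> 0 (- \<beta>) e1 e2 e3"
    and "lie_bracket G e1 e3 = vf_comb3 (- \<alpha>) (- \<beta>) 0 e1 e2 e3"
    and "lie_bracket G e2 e3 = vf_comb3 \<beta> \<alpha> \<alpha> e1 e2 e3"
    and "product_structure G J" and "left_invariant_endo G J"
    and "endo_app J e1 = e1" and "endo_app J e2 = e2" and "endo_app J e3 = vf_scale (-1) e3"
    and "levi_civita G g nab"
  shows "\<not> admits_left_invariant_ricci_collineations G g J e1 e2 e3 nab"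
proof
  interpret g1_frame G g e1 e2 e3 J nab \<alpha> \<beta>
  proof (intro g1_frame.intro pseudo_orthonormal_frame.intro g1_frame_axioms.intro)
    show "smooth_manifold G" using assms(2) by (simp add: lie_group_def)
    show "bilinear (g p)" for p
      using assms(5) unfolding lorentzian_metric_def by blast
    show "g p v w = g p w v" for p v w
      using assms(5) unfolding lorentzian_metric_def by blast
    show "vector_field G e1" "vector_field G e2" "vector_field G e3"
      using assms(7) by (auto simp: lie_algebra_basis_def lie_algebra_def)
    show "linear (J p)" for p using assms(12) by (simp add: product_structure_def)
  qed (fact assms)+
  assume "admits_left_invariant_ricci_collineations G g J e1 e2 e3 nab"
  then obtain \<xi> where \<xi>: "left_invariant_ricci_collineation G g J e1 e2 e3 nab \<xi>"
    and "\<xi> \<noteq> (\<lambda>p. 0)"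
    unfolding admits_left_invariant_ricci_collineations_def by blast
  from \<xi> have "\<xi> \<in> lie_algebra G" by (simp add: left_invariant_ricci_collineation_def)
  \<comment> \<open>Left-invariance enters here: it makes the coefficients of \<xi> real constants
    rather than functions.\<close>
  then have "\<exists>!(a, b, c). \<xi> = F a b c"
    using assms(7) by (simp add: lie_algebra_basis_def)
  then obtain l1 l2 l3 where l: "\<xi> = F l1 l2 l3"
    by (auto dest!: ex1_implies_ex)
  have "lie_derivative G (F l1 l2 l3)
      (symmetrized (ricci G g e1 e2 e3 (kobayashi_nomizu_conn nab J))) X Y p = 0"
    if "vector_field G X" "vector_field G Y" for X Y p
    using \<xi> that unfolding left_invariant_ricci_collineation_def l by metis
  from ricci_collineation_trivial[OF assms(1) this] have "l1 = 0" "l2 = 0" "l3 = 0"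
    by blast+
  then show False using \<open>\<xi> \<noteq> (\<lambda>p. 0)\<close> by (simp add: l vf_comb3_def)
qed

end
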